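(* Let $f$ and $\mathcal{F}$ satisfy Assumptions A and B of the context, and let $\{\mathbf{x}_k\}$ be the sequence of iterates generated by the Second Order Frank–Wolfe algorithm described in the context, applied to $\min_{\mathbf{x}\in\mathcal{F}}f(\mathbf{x})$. Then $$\lim_{k\to\infty}\mathcal{X}_k=\lim_{k\to\infty}\psi_{k,\alpha_k}=0.$$ In other words, any limit point of the iterates is a second order stationary point.
   Context: Problem: $\min_{\mathbf{x}\in\mathcal{F}}f(\mathbf{x})$, $f:\mathbb{R}^n\to\mathbb{R}$; norms are Euclidean (spectral for matrices). Stationarity measures: for $\mathbf{x}\in\mathcal{F}$, $$\mathcal{X}(\mathbf{x})=-\min_{\mathbf{s}}\{\langle\nabla f(\mathbf{x}),\mathbf{s}\rangle:\mathbf{x}+\mathbf{s}\in\mathcal{F},\|\mathbf{s}\|\le1\},$$ $$\psi(\mathbf{x},\alpha)=-\min_{\mathbf{d}}\{\mathbf{d}^T\nabla^2f(\mathbf{x})\mathbf{d}:\mathbf{x}+\mathbf{d}\in\mathcal{F},\|\mathbf{d}\|\le1,\langle\nabla f(\mathbf{x}),\mathbf{d}\rangle\le\alpha\}.$$ Write $\mathcal{X}_k=\mathcal{X}(\mathbf{x}_k)$ and $\psi_{k,\alpha}=\psi(\mathbf{x}_k,\alpha)$. A point $\bar{\mathbf{x}}\in\mathcal{F}$ is first order stationary if $\langle\nabla f(\bar{\mathbf{x}}),\mathbf{x}-\bar{\mathbf{x}}\rangle\ge0$ for all $\mathbf{x}\in\mathcal{F}$; it is second order stationary if moreover $\mathbf{d}^T\nabla^2f(\bar{\mathbf{x}})\mathbf{d}\ge0$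 for all $\mathbf{d}$ with $\langle\mathbf{d},\nabla f(\bar{\mathbf{x}})\rangle=0$ and $\bar{\mathbf{x}}+\mathbf{d}\in\mathcal{F}$. Assumption A: $f$ is twice continuously differentiable and bounded below by a scalar $f_{min}$ on $\mathcal{F}$; $\mathcal{F}$ is closed and convex; $\nabla f$ and $\nabla^2f$ are Lipschitz continuous with constants $L$ and $\rho$, respectively; there are constants $g_{max},H_{max}>0$ with $\|\nabla f(\mathbf{x}_k)\|_2\le g_{max}$ and $\|\nabla^2f(\mathbf{x}_k)\|_2\le H_{max}$ for all iterates $\mathbf{x}_k$. Assumption B: there is a constant $\beta>0$ such that every $\mathbf{x}\in\mathcal{F}$ with $\mathcal{X}(\mathbf{x})=0$ satisfies either $\psi(\mathbf{x},0)=0$ or $\psi(\mathbf{x},0)\ge\beta$. Algorithm (Second Order Frank–Wolfe with Fixed Step-size). Inputs: $\mathbf{x}_0\in\mathcal{F}$, $\widetilde L=\max\{L,g_{max}\}$, $\widetilde\rho=\max\{\rho,2H_{max}\}$, $\gamma>1$, $\alpha_0\in(0,1]$. For $k=0,1,2,\dots$: start with $\alpha_k$ equal to the input value $\alpha_0$. Compute $\mathcal{X}_k$ with a minimizer $\widehat{\mathbf{s}}_k$ of the problem defining $\mathcal{X}(\mathbf{x}_k)$, and $\psi_{k,\alpha_k}$ with a minimizer $\widehat{\mathbf{d}}_k$ of the problem defining $\psi(\mathbf{x}_k,\alpha_k)$. If $\psi_{k,\alpha_k}=\mathcal{X}_k=0$, terminate and return $\mathbf{x}_k$. Otherwise loop: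 (1) if $\frac{\mathcal{X}_k^2}{2\widetilde L}\ge\frac{\psi_{k,\alpha_k}^3}{3\widetilde\rho^2}$, set $\mathbf{x}_{k+1}=\mathbf{x}_k+\frac{\mathcal{X}_k}{\widetilde L}\widehat{\mathbf{s}}_k$ and exit the loop; (2) else, if $f(\mathbf{x}_k)-f\big(\mathbf{x}_k+\frac{2\psi_{k,\alpha_k}}{\widetilde\rho}\widehat{\mathbf{d}}_k\big)\ge\frac{\psi_{k,\alpha_k}^3}{3\widetilde\rho^2}$, $\ \widetilde\rho\ge2\psi_{k,\alpha_k}$ and $\langle\nabla f(\mathbf{x}_k),\widehat{\mathbf{d}}_k\rangle\le\frac{\psi_{k,\alpha_k}^2}{6\widetilde\rho}$ all hold, set $\mathbf{x}_{k+1}=\mathbf{x}_k+\frac{2\psi_{k,\alpha_k}}{\widetilde\rho}\widehat{\mathbf{d}}_k$ and exit the loop; (3) else replace $\alpha_k$ by $\alpha_k/\gamma$, recompute $\widehat{\mathbf{d}}_k,\psi_{k,\alpha_k}$ and return to (1). In $\psi_{k,\alpha_k}$ in the result, $\alpha_k$ denotes its value when the loop of iteration $k$ is exited. The limits refer to the case in which the algorithm generates an infinite sequence of iterates. *)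

theory Defs
  imports "HOL-Analysis.Analysis"
begin

section \<open>Gradient, Hessian and smoothness\<close>

definition grad :: "(real^'n \<Rightarrow> real) \<Rightarrow> real^'n \<Rightarrow> real^'n" where
  "grad f x = (THE g. GDERIV f x :> g)"

definition hess :: "(real^'n \<Rightarrow> real) \<Rightarrow> real^'n \<Rightarrow> real^'n^'n" where
  "hess f x = jacobian (grad f) (at x)"

text \<open>The norm of the type \<^typ>\<open>real^'n^'n\<close> is the Frobenius norm, so the spectral norm is
  introduced separately.\<close>

definition spectral_norm :: "real^'n^'n \<Rightarrow> real" where
  "spectral_norm A = onorm (\<lambda>v. A *v v)"

definition twice_continuously_differentiable :: "(real^'n \<Rightarrow> real) \<Rightarrow> bool" where
  "twice_continuously_differentiable f \<longleftrightarrow>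
     (\<forall>x. f differentiable (at x)) \<and>
     (\<forall>x. grad f differentiable (at x)) \<and>
     continuous_on UNIV (hess f)"

section \<open>Stationarity measures and stationary points\<close>

definition linear_feasible :: "(real^'n) set \<Rightarrow> real^'n \<Rightarrow> real^'n \<Rightarrow> bool" where
  "linear_feasible F x s \<longleftrightarrow> x + s \<in> F \<and> norm s \<le> 1"

definition quadratic_feasible ::
  "(real^'n \<Rightarrow> real) \<Rightarrow> (real^'n) set \<Rightarrow> real^'n \<Rightarrow> real \<Rightarrow> real^'n \<Rightarrow> bool" where
  "quadratic_feasible f F x \<alpha> d \<longleftrightarrow> x + d \<in> F \<and> norm d \<le> 1 \<and> grad f x \<bullet> d \<le> \<alpha>"

text \<open>For closed \<open>F\<close>, \<open>x \<in> F\<close> and \<open>\<alpha> \<ge> 0\<close> both feasible sets are compact and contain \<open>0\<close>, so the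
  infima below are minima.\<close>

definition fo_measure :: "(real^'n \<Rightarrow> real) \<Rightarrow> (real^'n) set \<Rightarrow> real^'n \<Rightarrow> real" where
  "fo_measure f F x = - (INF s\<in>{s. linear_feasible F x s}. grad f x \<bullet> s)"

definition so_measure :: "(real^'n \<Rightarrow> real) \<Rightarrow> (real^'n) set \<Rightarrow> real^'n \<Rightarrow> real \<Rightarrow> real" where
  "so_measure f F x \<alpha> =
     - (INF d\<in>{d. quadratic_feasible f F x \<alpha> d}. d \<bullet> (hess f x *v d))"

definition fo_minimizer ::
  "(real^'n \<Rightarrow> real) \<Rightarrow> (real^'n) set \<Rightarrow> real^'n \<Rightarrow> real^'n \<Rightarrow> bool" where
  "fo_minimizer f F x s \<longleftrightarrow>
     is_arg_min (\<lambda>s. grad f x \<bullet> s) (linear_feasible F x) s"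

definition so_minimizer ::
  "(real^'n \<Rightarrow> real) \<Rightarrow> (real^'n) set \<Rightarrow> real^'n \<Rightarrow> real \<Rightarrow> real^'n \<Rightarrow> bool" where
  "so_minimizer f F x \<alpha> d \<longleftrightarrow>
     is_arg_min (\<lambda>d. d \<bullet> (hess f x *v d)) (quadratic_feasible f F x \<alpha>) d"

definition first_order_stationary ::
  "(real^'n \<Rightarrow> real) \<Rightarrow> (real^'n) set \<Rightarrow> real^'n \<Rightarrow> bool" where
  "first_order_stationary f F z \<longleftrightarrow> z \<in> F \<and> (\<forall>x\<in>F. grad f z \<bullet> (x - z) \<ge> 0)"

definition second_order_stationary ::
  "(real^'n \<Rightarrow> real) \<Rightarrow> (real^'n) set \<Rightarrow> real^'n \<Rightarrow> bool" where
  "second_order_stationary f F z \<longleftrightarrow>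
     first_order_stationary f F z \<and>
     (\<forall>d. d \<bullet> grad f z = 0 \<and> z + d \<in> F \<longrightarrow> d \<bullet> (hess f z *v d) \<ge> 0)"

section \<open>Standing assumptions\<close>

text \<open>The Lipschitz conditions are only required on \<open>F\<close>; global Lipschitz continuity with the
  same constants is a special case.\<close>

definition assumption_A ::
  "(real^'n \<Rightarrow> real) \<Rightarrow> (real^'n) set \<Rightarrow> real \<Rightarrow> real \<Rightarrow> real \<Rightarrow> real \<Rightarrow> real \<Rightarrow>
   (nat \<Rightarrow> real^'n) \<Rightarrow> bool" where
  "assumption_A f F fmin L \<rho> gmax Hmax x \<longleftrightarrow>
     twice_continuously_differentiable f \<and>
     (\<forall>y\<in>F. fmin \<le> f y) \<and>
     closed F \<and> convex F \<and>
     L-lipschitz_on F (grad f) \<and>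
     0 \<le> \<rho> \<and>
     (\<forall>y\<in>F. \<forall>z\<in>F. spectral_norm (hess f y - hess f z) \<le> \<rho> * norm (y - z)) \<and>
     0 < gmax \<and> 0 < Hmax \<and>
     (\<forall>k. norm (grad f (x k)) \<le> gmax \<and> spectral_norm (hess f (x k)) \<le> Hmax)"

definition assumption_B :: "(real^'n \<Rightarrow> real) \<Rightarrow> (real^'n) set \<Rightarrow> bool" where
  "assumption_B f F \<longleftrightarrow>
     (\<exists>\<beta>>0. \<forall>x\<in>F. fo_measure f F x = 0 \<longrightarrow>
        so_measure f F x 0 = 0 \<or> so_measure f F x 0 \<ge> \<beta>)"

section \<open>Second Order Frank--Wolfe with fixed step-size\<close>

text \<open>In this section \<open>Lt\<close> and \<open>\<rho>t\<close> are the algorithm inputs \<open>max {L, gmax}\<close> and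
  \<open>max {\<rho>, 2 Hmax}\<close>.\<close>

definition fo_test ::
  "(real^'n \<Rightarrow> real) \<Rightarrow> (real^'n) set \<Rightarrow> real \<Rightarrow> real \<Rightarrow> real^'n \<Rightarrow> real \<Rightarrow> bool" where
  "fo_test f F Lt \<rho>t x \<alpha> \<longleftrightarrow>
     (fo_measure f F x)\<^sup>2 / (2 * Lt) \<ge> (so_measure f F x \<alpha>) ^ 3 / (3 * \<rho>t\<^sup>2)"

definition so_test ::
  "(real^'n \<Rightarrow> real) \<Rightarrow> (real^'n) set \<Rightarrow> real \<Rightarrow> real^'n \<Rightarrow> real \<Rightarrow> real^'n \<Rightarrow> bool" where
  "so_test f F \<rho>t x \<alpha> d \<longleftrightarrow>
     f x - f (x + (2 * so_measure f F x \<alpha> / \<rho>t) *\<^sub>R d) \<ge> (so_measure f F x \<alpha>) ^ 3 / (3 * \<rho>t\<^sup>2) \<and>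
     \<rho>t \<ge> 2 * so_measure f F x \<alpha> \<and>
     grad f x \<bullet> d \<le> (so_measure f F x \<alpha>)\<^sup>2 / (6 * \<rho>t)"

text \<open>\<open>sofw_loop f F Lt \<rho>t \<gamma> x s \<alpha> \<alpha>' x'\<close>: the inner loop at the iterate \<open>x\<close>, with computed
  minimizer \<open>s\<close> of the linear problem and entered with the value \<open>\<alpha>\<close>, can be exited after finitely
  many passes with the value \<open>\<alpha>'\<close> and the next iterate \<open>x'\<close>. The loop is a relation because the
  minimizers \<open>d\<close> need not be unique; a new one is chosen in each pass.\<close>

inductive sofw_loop ::
  "(real^'n \<Rightarrow> real) \<Rightarrow> (real^'n) set \<Rightarrow> real \<Rightarrow> real \<Rightarrow> real \<Rightarrow> real^'n \<Rightarrow> real^'n \<Rightarrow>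
   real \<Rightarrow> real \<Rightarrow> real^'n \<Rightarrow> bool"
  for f F Lt \<rho>t \<gamma> x s where
  fo_exit:
    "sofw_loop f F Lt \<rho>t \<gamma> x s \<alpha> \<alpha> (x + (fo_measure f F x / Lt) *\<^sub>R s)"
    if "so_minimizer f F x \<alpha> d" and "fo_test f F Lt \<rho>t x \<alpha>"
| so_exit:
    "sofw_loop f F Lt \<rho>t \<gamma> x s \<alpha> \<alpha> (x + (2 * so_measure f F x \<alpha> / \<rho>t) *\<^sub>R d)"
    if "so_minimizer f F x \<alpha> d" and "\<not> fo_test f F Lt \<rho>t x \<alpha>" and "so_test f F \<rho>t x \<alpha> d"
| shrink:
    "sofw_loop f F Lt \<rho>t \<gamma> x s \<alpha> \<alpha>' x'"
    if "so_minimizer f F x \<alpha> d" and "\<not> fo_test f F Lt \<rho>t x \<alpha>" and "\<not> so_test f F \<rho>t x \<alpha> d"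
      and "sofw_loop f F Lt \<rho>t \<gamma> x s (\<alpha> / \<gamma>) \<alpha>' x'"

text \<open>One full iteration from \<open>x\<close> that does not terminate the algorithm.\<close>

definition sofw_iteration ::
  "(real^'n \<Rightarrow> real) \<Rightarrow> (real^'n) set \<Rightarrow> real \<Rightarrow> real \<Rightarrow> real \<Rightarrow> real \<Rightarrow>
   real^'n \<Rightarrow> real \<Rightarrow> real^'n \<Rightarrow> bool" where
  "sofw_iteration f F Lt \<rho>t \<gamma> \<alpha>0 x \<alpha>' x' \<longleftrightarrow>
     \<not> (so_measure f F x \<alpha>0 = 0 \<and> fo_measure f F x = 0) \<and>
     (\<exists>s. fo_minimizer f F x s \<and> sofw_loop f F Lt \<rho>t \<gamma> x s \<alpha>0 \<alpha>' x')"

text \<open>An infinite run with iterates \<open>x k\<close>; \<open>\<alpha> k\<close> is the value at which the loop of iteration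
  \<open>k\<close> is exited, and each loop starts again from the input value \<open>\<alpha>0\<close>.\<close>

definition sofw_run ::
  "(real^'n \<Rightarrow> real) \<Rightarrow> (real^'n) set \<Rightarrow> real \<Rightarrow> real \<Rightarrow> real \<Rightarrow> real \<Rightarrow>
   (nat \<Rightarrow> real^'n) \<Rightarrow> (nat \<Rightarrow> real) \<Rightarrow> bool" where
  "sofw_run f F Lt \<rho>t \<gamma> \<alpha>0 x \<alpha> \<longleftrightarrow>
     x 0 \<in> F \<and> (\<forall>k. sofw_iteration f F Lt \<rho>t \<gamma> \<alpha>0 (x k) (\<alpha> k) (x (Suc k)))"

end

theory Submission
  imports Defs
begin

text \<open>
  Write \<open>X k\<close> and \<open>\<psi> k\<close> for the two measures at the \<open>k\<close>-th iterate, the second one taken at the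
  threshold with which the inner loop is left.

  The limits come from a sufficient decrease argument. Both step lengths lie in \<open>[0, 1]\<close>, because
  \<open>X k \<le> gmax\<close> and \<open>2 * \<psi> k \<le> \<rho>t\<close>, so the iterates stay in the convex set \<open>F\<close> and Taylor bounds apply
  on the segment between consecutive iterates. A first order step decreases \<open>f\<close> by at least
  \<open>(X k)\<^sup>2 / (2 * Lt)\<close>, and a second order step is accepted only if \<open>f\<close> decreases by
  \<open>(\<psi> k) ^ 3 / (3 * \<rho>t\<^sup>2)\<close>. The test that chooses between the steps compares exactly these two numbers,
  so every iteration decreases \<open>f\<close> by the larger of them (\<open>sofw_loop_decrease\<close>). As \<open>f\<close> is bounded below
  on \<open>F\<close>, the decreases tend to zero, and so do \<open>X k\<close> and \<open>\<psi> k\<close>.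

  At a limit point \<open>z\<close>, a direction \<open>d\<close> with \<open>z + d \<in> F\<close> and \<open>norm d < 1\<close> is compared with the directions
  \<open>z + d - y\<close> at nearby iterates \<open>y\<close>. They lead to the same point of \<open>F\<close>, converge to \<open>d\<close>, and are
  feasible as soon as their norm is at most one. Since \<open>F\<close> is convex, such short directions suffice.
  With \<open>X k \<rightarrow> 0\<close> this gives first order stationarity.

  For the second order condition, \<open>\<psi> k \<rightarrow> 0\<close> alone is too weak, as the exit thresholds might tend to
  zero as well. Suppose that \<open>d\<close> is orthogonal to the gradient and has negative curvature at \<open>z\<close>. Then
  there is a \<open>b > 0\<close> such that, for every fixed \<open>c > 0\<close>, the second order measure at all thresholds
  \<open>a \<ge> c\<close> is at least \<open>b\<close> near \<open>z\<close> (\<open>so_measure_bounded_below_near_negative_curvature\<close>). On the other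
  hand, a third order Taylor bound shows that the second order step is accepted once the threshold is
  at most \<open>\<psi>\<^sup>2 / (6 * \<rho>t)\<close> (\<open>so_test_if_small_threshold\<close>). Take for \<open>c\<close> a threshold
  \<open>\<alpha>0 / \<gamma> ^ n \<le> b\<^sup>2 / (6 * \<rho>t)\<close>: near \<open>z\<close> the loop cannot go past \<open>c\<close>, so it is left at some threshold
  \<open>\<ge> c\<close>, where the measure is at least \<open>b\<close> (\<open>so_measure_at_loop_exit_ge\<close>). This contradicts
  \<open>\<psi> k \<rightarrow> 0\<close>.
\<close>

section \<open>Taylor bounds on a convex set\<close>

lemma GDERIV_grad:
  assumes "f differentiable (at x)"
  shows "GDERIV f x :> grad f x"
proof -
  obtain D where D: "(f has_derivative D) (at x)"
    using assms by (auto simp: differentiable_def)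
  have "D h = h \<bullet> adjoint D 1" for h
    using adjoint_works[of D h "1::real"] has_derivative_linear[OF D] by simp
  then have "D = (\<lambda>h. h \<bullet> adjoint D 1)"
    by blast
  with D have ex: "GDERIV f x :> adjoint D 1"
    by (simp add: gderiv_def)
  have "g = adjoint D 1" if "GDERIV f x :> g" for g
  proof -
    have eq: "(\<lambda>h. h \<bullet> g) = (\<lambda>h. h \<bullet> adjoint D 1)"
      using that ex unfolding gderiv_def by (rule has_derivative_unique)
    have "h \<bullet> g = h \<bullet> adjoint D 1" for h
      using fun_cong[OF eq, of h] .
    then show ?thesis
      using vector_eq_ldot by blast
  qed
  with ex show ?thesis
    unfolding grad_def by (rule theI)
qed

lemma DERIV_along_line:
  fixes f :: "real^'n \<Rightarrow> real"
  assumes "\<And>y. f differentiable (at y)"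
  shows "((\<lambda>t. f (x + t *\<^sub>R d)) has_real_derivative grad f (x + t *\<^sub>R d) \<bullet> d) (at t)"
proof -
  have line: "((\<lambda>t. x + t *\<^sub>R d) has_derivative (\<lambda>h. h *\<^sub>R d)) (at t)"
    by (auto intro!: derivative_eq_intros)
  have "(f has_derivative (\<lambda>h. h \<bullet> grad f (x + t *\<^sub>R d))) (at (x + t *\<^sub>R d))"
    using GDERIV_grad[OF assms] by (simp add: gderiv_def)
  from has_derivative_compose[OF line this] show ?thesis
    by (simp add: has_field_derivative_def inner_commute mult_commute_abs)
qed

lemma DERIV_grad_along_line:
  fixes f :: "real^'n \<Rightarrow> real"
  assumes "\<And>y. grad f differentiable (at y)"
  shows "((\<lambda>t. grad f (x + t *\<^sub>R d) \<bullet> d) has_real_derivative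
           d \<bullet> (hess f (x + t *\<^sub>R d) *v d)) (at t)"
proof -
  have line: "((\<lambda>t. x + t *\<^sub>R d) has_derivative (\<lambda>h. h *\<^sub>R d)) (at t)"
    by (auto intro!: derivative_eq_intros)
  have "(grad f has_derivative (\<lambda>h. hess f (x + t *\<^sub>R d) *v h)) (at (x + t *\<^sub>R d))"
    using assms unfolding hess_def by (simp add: jacobian_works)
  from has_derivative_inner_left[OF has_derivative_compose[OF line this], of d] show ?thesis
    by (simp add: has_field_derivative_def inner_commute mult_commute_abs
        matrix_vector_mult_scaleR)
qed

lemma convex_segment_point:
  assumes "convex F" "x \<in> F" "x + d \<in> F" "0 \<le> t" "t \<le> (1::real)"
  shows "x + t *\<^sub>R d \<in> F"
  using convexD[OF assms(1,2,3), of "1 - t" t] assms(4,5)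
  by (simp add: algebra_simps)

text \<open>Both Taylor bounds are obtained by integrating a bound on the last derivative along the segment;
  this is one such integration.\<close>

lemma mono_bound_from_derivative:
  fixes g h :: "real \<Rightarrow> real"
  assumes "\<And>t. DERIV g t :> g' t" "\<And>t. DERIV h t :> h' t"
    and "\<And>t. 0 \<le> t \<Longrightarrow> t \<le> 1 \<Longrightarrow> g' t \<le> h' t"
    and "g 0 = h 0" "0 \<le> u" "u \<le> 1"
  shows "g u \<le> h u"
proof -
  have "(\<lambda>t. h t - g t) 0 \<le> (\<lambda>t. h t - g t) u"
  proof (rule DERIV_nonneg_imp_nondecreasing[OF \<open>0 \<le> u\<close>])
    fix t assume "0 \<le> t" "t \<le> u"
    then show "\<exists>y. DERIV (\<lambda>t. h t - g t) t :> y \<and> 0 \<le> y"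
      using assms(1,2)[of t] assms(3)[of t] \<open>u \<le> 1\<close>
      by (intro exI[of _ "h' t - g' t"]) (auto intro: derivative_intros)
  qed
  with \<open>g 0 = h 0\<close> show ?thesis by simp
qed

text \<open>Differentiability is used in the whole space but Lipschitz continuity only between points of \<open>F\<close>:
  convexity keeps the segment from \<open>x\<close> to \<open>x + d\<close> inside \<open>F\<close>, and the one-dimensional function
  \<open>t \<mapsto> f (x + t *\<^sub>R d)\<close> is all that matters.\<close>

lemma taylor_upper_bound_Lipschitz_grad:
  fixes f :: "real^'n \<Rightarrow> real"
  assumes diff: "\<And>y. f differentiable (at y)"
    and lip: "L-lipschitz_on F (grad f)"
    and F: "convex F" "x \<in> F" "x + d \<in> F"
  shows "f (x + d) \<le> f x + grad f x \<bullet> d + L / 2 * (norm d)\<^sup>2"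
proof -
  let ?q = "\<lambda>t. f x + t * (grad f x \<bullet> d) + L / 2 * t\<^sup>2 * (norm d)\<^sup>2"
  have q: "DERIV ?q t :> grad f x \<bullet> d + L * t * (norm d)\<^sup>2" for t
    by (auto intro!: derivative_eq_intros)
  have "grad f (x + t *\<^sub>R d) \<bullet> d \<le> grad f x \<bullet> d + L * t * (norm d)\<^sup>2"
    if t: "0 \<le> t" "t \<le> 1" for t
  proof -
    have "(grad f (x + t *\<^sub>R d) - grad f x) \<bullet> d \<le> norm (grad f (x + t *\<^sub>R d) - grad f x) * norm d"
      by (rule norm_cauchy_schwarz)
    also have "\<dots> \<le> (L * norm (t *\<^sub>R d)) * norm d"
      using lipschitz_onD[OF lip convex_segment_point[OF F t] F(2)]
      by (intro mult_right_mono) (auto simp: dist_norm)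
    finally show ?thesis
      using t by (simp add: inner_diff_left power2_eq_square algebra_simps)
  qed
  from mono_bound_from_derivative[OF DERIV_along_line[OF diff, of x d] q this, of 1]
  show ?thesis by simp
qed

lemma quadratic_form_le_spectral_norm:
  "\<bar>d \<bullet> (A *v d)\<bar> \<le> spectral_norm A * (norm d)\<^sup>2"
proof -
  have "\<bar>d \<bullet> (A *v d)\<bar> \<le> norm d * norm (A *v d)"
    by (rule Cauchy_Schwarz_ineq2)
  also have "\<dots> \<le> norm d * (spectral_norm A * norm d)"
    unfolding spectral_norm_def
    by (intro mult_left_mono onorm matrix_vector_mul_bounded_linear) simp
  finally show ?thesis
    by (simp add: power2_eq_square algebra_simps)
qed

lemma taylor_upper_bound_Lipschitz_hess:
  fixes f :: "real^'n \<Rightarrow> real"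
  assumes diff: "\<And>y. f differentiable (at y)" "\<And>y. grad f differentiable (at y)"
    and lip: "\<And>y z. y \<in> F \<Longrightarrow> z \<in> F \<Longrightarrow> spectral_norm (hess f y - hess f z) \<le> \<rho> * norm (y - z)"
    and F: "convex F" "x \<in> F" "x + d \<in> F"
  shows "f (x + d) \<le> f x + grad f x \<bullet> d + (d \<bullet> (hess f x *v d)) / 2 + \<rho> / 6 * (norm d) ^ 3"
proof -
  \<comment> \<open>\<open>?c\<close> is the claimed cubic bound along the segment and \<open>?q\<close> its derivative; the Hessian bound is
    integrated twice.\<close>
  let ?q = "\<lambda>t. grad f x \<bullet> d + t * (d \<bullet> (hess f x *v d)) + \<rho> / 2 * t\<^sup>2 * (norm d) ^ 3"
  let ?c = "\<lambda>t. f x + t * (grad f x \<bullet> d) + t\<^sup>2 / 2 * (d \<bullet> (hess f x *v d))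
                 + \<rho> / 6 * t ^ 3 * (norm d) ^ 3"
  have q: "DERIV ?q t :> d \<bullet> (hess f x *v d) + \<rho> * t * (norm d) ^ 3" for t
    by (auto intro!: derivative_eq_intros)
  have c: "DERIV ?c t :> ?q t" for t
    by (auto intro!: derivative_eq_intros simp: power2_eq_square)
  have "d \<bullet> (hess f (x + t *\<^sub>R d) *v d) \<le> d \<bullet> (hess f x *v d) + \<rho> * t * (norm d) ^ 3"
    if t: "0 \<le> t" "t \<le> 1" for t
  proof -
    have "d \<bullet> ((hess f (x + t *\<^sub>R d) - hess f x) *v d)
        \<le> spectral_norm (hess f (x + t *\<^sub>R d) - hess f x) * (norm d)\<^sup>2"
      using quadratic_form_le_spectral_norm abs_le_D1 by blast
    also have "\<dots> \<le> (\<rho> * norm (t *\<^sub>R d)) * (norm d)\<^sup>2"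
      using lip[OF convex_segment_point[OF F t] F(2)] by (intro mult_right_mono) auto
    finally show ?thesis
      using t by (simp add: matrix_vector_mult_diff_rdistrib inner_diff_right
          power2_eq_square power3_eq_cube algebra_simps)
  qed
  from mono_bound_from_derivative[OF DERIV_grad_along_line[OF diff(2), of x d] q this]
  have "grad f (x + t *\<^sub>R d) \<bullet> d \<le> ?q t" if "0 \<le> t" "t \<le> 1" for t
    using that by simp
  from mono_bound_from_derivative[OF DERIV_along_line[OF diff(1), of x d] c this, of 1]
  show ?thesis by simp
qed

section \<open>The stationarity measures\<close>

text \<open>A real infimum is a lower bound only if the set is bounded below; on the unit ball the two
  objectives are bounded by the norm of the gradient and the spectral norm of the Hessian.\<close>

lemma fo_measure_ge:
  assumes "linear_feasible F x s"
  shows "- (grad f x \<bullet> s) \<le> fo_measure f F x"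
proof -
  have "- norm (grad f x) \<le> grad f x \<bullet> u" if "linear_feasible F x u" for u
  proof -
    have "\<bar>grad f x \<bullet> u\<bar> \<le> norm (grad f x) * norm u"
      by (rule Cauchy_Schwarz_ineq2)
    also have "\<dots> \<le> norm (grad f x)"
      using that by (intro mult_left_le) (auto simp: linear_feasible_def)
    finally show ?thesis by linarith
  qed
  then have "bdd_below ((\<lambda>s. grad f x \<bullet> s) ` {s. linear_feasible F x s})"
    by (intro bdd_belowI2) auto
  from cINF_lower[OF this] assms show ?thesis
    by (simp add: fo_measure_def)
qed

lemma fo_measure_eq:
  assumes "fo_minimizer f F x s"
  shows "fo_measure f F x = - (grad f x \<bullet> s)"
  using assms unfolding fo_measure_def fo_minimizer_def is_arg_min_def
  by (intro arg_cong[where f = uminus] cInf_eq_minimum) (auto simp: not_less)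

lemma so_measure_ge:
  assumes "quadratic_feasible f F x \<alpha> d"
  shows "- (d \<bullet> (hess f x *v d)) \<le> so_measure f F x \<alpha>"
proof -
  have "- \<bar>spectral_norm (hess f x)\<bar> \<le> u \<bullet> (hess f x *v u)" if "norm u \<le> 1" for u
  proof -
    have "\<bar>u \<bullet> (hess f x *v u)\<bar> \<le> spectral_norm (hess f x) * (norm u)\<^sup>2"
      by (rule quadratic_form_le_spectral_norm)
    also have "\<dots> \<le> \<bar>spectral_norm (hess f x)\<bar> * (norm u)\<^sup>2"
      by (intro mult_right_mono) auto
    also have "\<dots> \<le> \<bar>spectral_norm (hess f x)\<bar>"
      using that by (intro mult_left_le) (auto simp: power_le_one)
    finally show ?thesis by linarith
  qed
  then have "bdd_below ((\<lambda>d. d \<bullet> (hess f x *v d)) ` {d. quadratic_feasible f F x \<alpha> d})"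
    by (intro bdd_belowI2[where m = "- \<bar>spectral_norm (hess f x)\<bar>"])
      (auto simp: quadratic_feasible_def)
  from cINF_lower[OF this] assms show ?thesis
    by (simp add: so_measure_def)
qed

lemma so_measure_eq:
  assumes "so_minimizer f F x \<alpha> d"
  shows "so_measure f F x \<alpha> = - (d \<bullet> (hess f x *v d))"
  using assms unfolding so_measure_def so_minimizer_def is_arg_min_def
  by (intro arg_cong[where f = uminus] cInf_eq_minimum) (auto simp: not_less)

lemma fo_measure_nonneg: "x \<in> F \<Longrightarrow> 0 \<le> fo_measure f F x"
  using fo_measure_ge[of F x 0 f] by (simp add: linear_feasible_def)

lemma so_measure_nonneg: "x \<in> F \<Longrightarrow> 0 \<le> \<alpha> \<Longrightarrow> 0 \<le> so_measure f F x \<alpha>"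
  using so_measure_ge[of f F x \<alpha> 0] by (simp add: quadratic_feasible_def)

lemma so_measure_le_spectral_norm:
  assumes "so_minimizer f F x \<alpha> d" "spectral_norm (hess f x) \<le> H" "0 \<le> H"
  shows "so_measure f F x \<alpha> \<le> H"
proof -
  have "norm d \<le> 1"
    using assms(1) by (auto simp: so_minimizer_def is_arg_min_def quadratic_feasible_def)
  have "so_measure f F x \<alpha> \<le> spectral_norm (hess f x) * (norm d)\<^sup>2"
    using quadratic_form_le_spectral_norm[of d "hess f x"] so_measure_eq[OF assms(1)] by linarith
  also have "\<dots> \<le> H * (norm d)\<^sup>2"
    using assms(2) by (intro mult_right_mono) auto
  also have "\<dots> \<le> H"
    using \<open>norm d \<le> 1\<close> assms(3) by (intro mult_left_le) (auto simp: power_le_one)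
  finally show ?thesis .
qed

section \<open>Decrease of the objective in one iteration\<close>

text \<open>Along a minimizer \<open>s\<close> the slope is \<open>- X\<close>, so a step of length \<open>\<eta>\<close> changes \<open>f\<close> by at most
  \<open>- \<eta> * X + Lt / 2 * \<eta>\<^sup>2\<close>; the step size \<open>X / Lt\<close> minimizes this bound.\<close>

lemma fo_step:
  fixes f :: "real^'n \<Rightarrow> real"
  assumes diff: "\<And>y. f differentiable (at y)"
    and lip: "L-lipschitz_on F (grad f)" and "L \<le> Lt" "0 < Lt"
    and F: "convex F" "x \<in> F" and grad: "norm (grad f x) \<le> Lt"
    and s: "fo_minimizer f F x s"
  defines "y \<equiv> x + (fo_measure f F x / Lt) *\<^sub>R s"
  shows "y \<in> F \<and> (fo_measure f F x)\<^sup>2 / (2 * Lt) \<le> f x - f y"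
proof -
  define X where "X = fo_measure f F x"
  have s1: "x + s \<in> F" "norm s \<le> 1"
    using s by (auto simp: fo_minimizer_def is_arg_min_def linear_feasible_def)
  have X: "grad f x \<bullet> s = - X" "0 \<le> X"
    using fo_measure_eq[OF s] fo_measure_nonneg[OF F(2), of f] by (auto simp: X_def)
  have "\<bar>grad f x \<bullet> s\<bar> \<le> norm (grad f x) * norm s"
    by (rule Cauchy_Schwarz_ineq2)
  also have "\<dots> \<le> Lt"
    using s1 grad \<open>0 < Lt\<close> mult_mono[of "norm (grad f x)" Lt "norm s" 1] by simp
  finally have "X / Lt \<le> 1" "0 \<le> X / Lt"
    using X \<open>0 < Lt\<close> by auto
  then have y: "y \<in> F"
    unfolding y_def X_def[symmetric] by (intro convex_segment_point F s1)
  have "f y \<le> f x + grad f x \<bullet> ((X / Lt) *\<^sub>R s) + L / 2 * (norm ((X / Lt) *\<^sub>R s))\<^sup>2"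
    using taylor_upper_bound_Lipschitz_grad[OF diff lip F, of "(X / Lt) *\<^sub>R s"] y
    by (simp add: y_def X_def)
  also have "\<dots> = f x - X\<^sup>2 / Lt + L * ((X / Lt)\<^sup>2 * (norm s)\<^sup>2) / 2"
    using X by (simp add: power_mult_distrib power2_eq_square ac_simps)
  also have "L * ((X / Lt)\<^sup>2 * (norm s)\<^sup>2) \<le> Lt * (X / Lt)\<^sup>2"
    using s1(2) \<open>L \<le> Lt\<close> \<open>0 < Lt\<close>
    by (intro mult_mono mult_left_le) (auto simp: power_le_one)
  also have "Lt * (X / Lt)\<^sup>2 = X\<^sup>2 / Lt"
    using \<open>0 < Lt\<close> by (simp add: power2_eq_square)
  finally have "f y \<le> f x - X\<^sup>2 / Lt + X\<^sup>2 / Lt / 2"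
    by simp
  with y show ?thesis
    by (simp add: X_def)
qed

text \<open>With \<open>p\<close> the second order measure and \<open>\<eta> = 2 * p / \<rho>t\<close>, the terms of the third order Taylor bound
  are, in units of \<open>p ^ 3 / \<rho>t\<^sup>2\<close>, at most \<open>1/3\<close> (slope, by the assumption on \<open>\<alpha>\<close>), \<open>- 2\<close> (curvature)
  and \<open>4/3\<close> (remainder). Their sum \<open>- 1/3\<close> is the decrease that the test asks for.\<close>

lemma so_test_if_small_threshold:
  fixes f :: "real^'n \<Rightarrow> real"
  assumes diff: "\<And>y. f differentiable (at y)" "\<And>y. grad f differentiable (at y)"
    and lip: "\<And>y z. y \<in> F \<Longrightarrow> z \<in> F \<Longrightarrow> spectral_norm (hess f y - hess f z) \<le> \<rho> * norm (y - z)"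
    and "\<rho> \<le> \<rho>t" "0 < \<rho>t"
    and F: "convex F" "x \<in> F"
    and hess: "2 * spectral_norm (hess f x) \<le> \<rho>t"
    and d: "so_minimizer f F x \<alpha> d" and "0 \<le> \<alpha>"
    and \<alpha>: "\<alpha> \<le> (so_measure f F x \<alpha>)\<^sup>2 / (6 * \<rho>t)"
  shows "so_test f F \<rho>t x \<alpha> d"
proof -
  define p where "p = so_measure f F x \<alpha>"
  define \<eta> where "\<eta> = 2 * p / \<rho>t"
  have d1: "x + d \<in> F" "norm d \<le> 1" "grad f x \<bullet> d \<le> \<alpha>"
    using d by (auto simp: so_minimizer_def is_arg_min_def quadratic_feasible_def)
  have p: "d \<bullet> (hess f x *v d) = - p" "0 \<le> p"
    using so_measure_eq[OF d] so_measure_nonneg[OF F(2) \<open>0 \<le> \<alpha>\<close>, of f] by (auto simp: p_def)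
  have p2: "2 * p \<le> \<rho>t"
    using so_measure_le_spectral_norm[OF d, of "\<rho>t / 2"] hess \<open>0 < \<rho>t\<close> by (simp add: p_def)
  have \<eta>: "0 \<le> \<eta>" "\<eta> \<le> 1"
    using p p2 \<open>0 < \<rho>t\<close> by (auto simp: \<eta>_def)
  have slope: "grad f x \<bullet> d \<le> p\<^sup>2 / (6 * \<rho>t)"
    using d1(3) \<alpha> by (simp add: p_def)
  have "f (x + \<eta> *\<^sub>R d) \<le> f x + grad f x \<bullet> (\<eta> *\<^sub>R d)
      + ((\<eta> *\<^sub>R d) \<bullet> (hess f x *v (\<eta> *\<^sub>R d))) / 2 + \<rho> / 6 * (norm (\<eta> *\<^sub>R d)) ^ 3"
    by (intro taylor_upper_bound_Lipschitz_hess[OF diff lip F] convex_segment_point F d1 \<eta>)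
  also have "\<dots> = f x + \<eta> * (grad f x \<bullet> d) - \<eta>\<^sup>2 * p / 2 + \<rho> * (\<eta> ^ 3 * norm d ^ 3) / 6"
    using p \<eta> by (simp add: matrix_vector_mult_scaleR power2_eq_square power_mult_distrib)
  also have "\<dots> \<le> f x + \<eta> * (p\<^sup>2 / (6 * \<rho>t)) - \<eta>\<^sup>2 * p / 2 + \<rho>t * \<eta> ^ 3 / 6"
  proof -
    have "\<rho> * (\<eta> ^ 3 * norm d ^ 3) \<le> \<rho>t * \<eta> ^ 3"
      using \<open>\<rho> \<le> \<rho>t\<close> \<open>0 < \<rho>t\<close> \<eta> d1(2)
      by (intro mult_mono mult_left_le) (auto simp: power_le_one)
    moreover have "\<eta> * (grad f x \<bullet> d) \<le> \<eta> * (p\<^sup>2 / (6 * \<rho>t))"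
      using slope \<eta>(1) by (rule mult_left_mono)
    ultimately show ?thesis by simp
  qed
  also have "\<dots> = f x - p ^ 3 / (3 * \<rho>t\<^sup>2)"
    using \<open>0 < \<rho>t\<close> by (simp add: \<eta>_def field_simps power2_eq_square power3_eq_cube)
  finally have "p ^ 3 / (3 * \<rho>t\<^sup>2) \<le> f x - f (x + \<eta> *\<^sub>R d)"
    by simp
  with p2 slope show ?thesis
    unfolding so_test_def p_def \<eta>_def by simp
qed

section \<open>The inner loop\<close>

text \<open>What a pass through the loop leaves behind: the exit threshold is the \<open>m\<close>-th one, the second order
  test failed at every earlier one, and the exit took one of the two possible steps.\<close>

lemma sofw_loop_history:
  assumes "sofw_loop f F Lt \<rho>t \<gamma> x s \<alpha> \<alpha>' x'"
  shows "\<exists>m d. \<alpha>' = \<alpha> / \<gamma> ^ m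
    \<and> (\<forall>i<m. \<exists>e. so_minimizer f F x (\<alpha> / \<gamma> ^ i) e \<and> \<not> so_test f F \<rho>t x (\<alpha> / \<gamma> ^ i) e)
    \<and> so_minimizer f F x \<alpha>' d
    \<and> (fo_test f F Lt \<rho>t x \<alpha>' \<and> x' = x + (fo_measure f F x / Lt) *\<^sub>R s
       \<or> \<not> fo_test f F Lt \<rho>t x \<alpha>' \<and> so_test f F \<rho>t x \<alpha>' d
         \<and> x' = x + (2 * so_measure f F x \<alpha>' / \<rho>t) *\<^sub>R d)"
  using assms
proof (induction rule: sofw_loop.induct)
  case (fo_exit \<alpha> d)
  then show ?case by (intro exI[of _ 0] exI[of _ d]) auto
next
  case (so_exit \<alpha> d)
  then show ?case by (intro exI[of _ 0] exI[of _ d]) auto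
next
  case (shrink \<alpha> d \<alpha>' x')
  let ?fails = "\<lambda>a. \<exists>e. so_minimizer f F x a e \<and> \<not> so_test f F \<rho>t x a e"
  from shrink.IH obtain m d' where
    IH: "\<alpha>' = \<alpha> / \<gamma> / \<gamma> ^ m" "\<forall>i<m. ?fails (\<alpha> / \<gamma> / \<gamma> ^ i)" "so_minimizer f F x \<alpha>' d'"
      "fo_test f F Lt \<rho>t x \<alpha>' \<and> x' = x + (fo_measure f F x / Lt) *\<^sub>R s
       \<or> \<not> fo_test f F Lt \<rho>t x \<alpha>' \<and> so_test f F \<rho>t x \<alpha>' d'
         \<and> x' = x + (2 * so_measure f F x \<alpha>' / \<rho>t) *\<^sub>R d'"
    by blast
  have "?fails (\<alpha> / \<gamma> ^ i)" if "i < Suc m" for i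
  proof (cases i)
    case 0
    with shrink.hyps show ?thesis by auto
  next
    case (Suc j)
    then show ?thesis using that IH(2) by simp
  qed
  with IH show ?case
    by (intro exI[of _ "Suc m"] exI[of _ d']) auto
qed

text \<open>Whichever step is taken, its own guaranteed decrease dominates the other one by the outcome of the
  first test, so both lower bounds hold in every iteration.\<close>

lemma sofw_loop_decrease:
  fixes f :: "real^'n \<Rightarrow> real"
  assumes diff: "\<And>y. f differentiable (at y)"
    and lip: "L-lipschitz_on F (grad f)" and "L \<le> Lt" "0 < Lt" "0 < \<rho>t"
    and F: "convex F" "x \<in> F" and grad: "norm (grad f x) \<le> Lt"
    and s: "fo_minimizer f F x s" and "1 < \<gamma>" "0 < \<alpha>"
    and loop: "sofw_loop f F Lt \<rho>t \<gamma> x s \<alpha> \<alpha>' x'"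
  shows "x' \<in> F" "0 \<le> so_measure f F x \<alpha>'"
    "(fo_measure f F x)\<^sup>2 / (2 * Lt) \<le> f x - f x'"
    "(so_measure f F x \<alpha>') ^ 3 / (3 * \<rho>t\<^sup>2) \<le> f x - f x'"
proof -
  from sofw_loop_history[OF loop] obtain m d where
    h: "\<alpha>' = \<alpha> / \<gamma> ^ m" "so_minimizer f F x \<alpha>' d"
      "fo_test f F Lt \<rho>t x \<alpha>' \<and> x' = x + (fo_measure f F x / Lt) *\<^sub>R s
       \<or> \<not> fo_test f F Lt \<rho>t x \<alpha>' \<and> so_test f F \<rho>t x \<alpha>' d
         \<and> x' = x + (2 * so_measure f F x \<alpha>' / \<rho>t) *\<^sub>R d"
    by blast
  show p: "0 \<le> so_measure f F x \<alpha>'"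
    using h(1) \<open>1 < \<gamma>\<close> \<open>0 < \<alpha>\<close> by (intro so_measure_nonneg F) auto
  have "x' \<in> F \<and> (fo_measure f F x)\<^sup>2 / (2 * Lt) \<le> f x - f x'
    \<and> (so_measure f F x \<alpha>') ^ 3 / (3 * \<rho>t\<^sup>2) \<le> f x - f x'"
    using h(3)
  proof
    assume "fo_test f F Lt \<rho>t x \<alpha>' \<and> x' = x + (fo_measure f F x / Lt) *\<^sub>R s"
    with fo_step[OF diff lip \<open>L \<le> Lt\<close> \<open>0 < Lt\<close> F grad s] show ?thesis
      by (auto simp: fo_test_def)
  next
    assume so: "\<not> fo_test f F Lt \<rho>t x \<alpha>' \<and> so_test f F \<rho>t x \<alpha>' d
         \<and> x' = x + (2 * so_measure f F x \<alpha>' / \<rho>t) *\<^sub>R d"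
    have "x + d \<in> F"
      using h(2) by (auto simp: so_minimizer_def is_arg_min_def quadratic_feasible_def)
    moreover have "2 * so_measure f F x \<alpha>' / \<rho>t \<le> 1"
      using so \<open>0 < \<rho>t\<close> by (simp add: so_test_def)
    ultimately have "x' \<in> F"
      using so p \<open>0 < \<rho>t\<close> by (auto intro!: convex_segment_point F)
    with so show ?thesis
      by (auto simp: fo_test_def so_test_def)
  qed
  then show "x' \<in> F" "(fo_measure f F x)\<^sup>2 / (2 * Lt) \<le> f x - f x'"
    "(so_measure f F x \<alpha>') ^ 3 / (3 * \<rho>t\<^sup>2) \<le> f x - f x'" by auto
qed

text \<open>A threshold that is small compared with the measure there is a barrier for the loop, since the second
  order test succeeds at it. Hence a lower bound on the measure above the barrier also holds at the
  exit threshold.\<close>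

lemma so_measure_at_loop_exit_ge:
  fixes f :: "real^'n \<Rightarrow> real"
  assumes diff: "\<And>y. f differentiable (at y)" "\<And>y. grad f differentiable (at y)"
    and lip: "\<And>y z. y \<in> F \<Longrightarrow> z \<in> F \<Longrightarrow> spectral_norm (hess f y - hess f z) \<le> \<rho> * norm (y - z)"
    and "\<rho> \<le> \<rho>t" "0 < \<rho>t"
    and F: "convex F" "x \<in> F"
    and hess: "2 * spectral_norm (hess f x) \<le> \<rho>t"
    and loop: "sofw_loop f F Lt \<rho>t \<gamma> x s \<alpha> \<alpha>' x'" and "1 < \<gamma>" "0 < \<alpha>"
    and small: "\<alpha> / \<gamma> ^ n \<le> b\<^sup>2 / (6 * \<rho>t)" and "0 < b"
    and b: "\<And>a. \<alpha> / \<gamma> ^ n \<le> a \<Longrightarrow> b \<le> so_measure f F x a"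
  shows "b \<le> so_measure f F x \<alpha>'"
proof -
  define c where "c = \<alpha> / \<gamma> ^ n"
  have "0 < c" using \<open>1 < \<gamma>\<close> \<open>0 < \<alpha>\<close> by (simp add: c_def)
  from sofw_loop_history[OF loop] obtain m where
    m: "\<alpha>' = \<alpha> / \<gamma> ^ m"
      "\<And>i. i < m \<Longrightarrow> \<exists>e. so_minimizer f F x (\<alpha> / \<gamma> ^ i) e \<and> \<not> so_test f F \<rho>t x (\<alpha> / \<gamma> ^ i) e"
    by blast
  have "m \<le> n"
  proof (rule ccontr)
    assume "\<not> m \<le> n"
    with m(2)[of n] obtain e where
      e: "so_minimizer f F x c e" "\<not> so_test f F \<rho>t x c e"
      by (auto simp: c_def)
    have "b\<^sup>2 / (6 * \<rho>t) \<le> (so_measure f F x c)\<^sup>2 / (6 * \<rho>t)"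
      using b[of c] \<open>0 < b\<close> \<open>0 < \<rho>t\<close> unfolding c_def
      by (intro divide_right_mono power_mono) auto
    with small have "c \<le> (so_measure f F x c)\<^sup>2 / (6 * \<rho>t)"
      by (simp add: c_def)
    with \<open>0 < c\<close> e(2) show False
      using so_test_if_small_threshold[OF diff lip \<open>\<rho> \<le> \<rho>t\<close> \<open>0 < \<rho>t\<close> F hess e(1)] by simp
  qed
  then have "\<alpha> / \<gamma> ^ n \<le> \<alpha>'"
    using \<open>1 < \<gamma>\<close> \<open>0 < \<alpha>\<close> unfolding m(1)
    by (intro divide_left_mono power_increasing) auto
  then show ?thesis by (rule b)
qed

section \<open>Convergence of the measures and stationarity of limit points\<close>

lemma tendsto_0_if_power_bounded_by_decrease:
  fixes a u :: "nat \<Rightarrow> real"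
  assumes "\<And>k. 0 \<le> a k" "\<And>k. a k ^ n / c \<le> u k - u (Suc k)" "\<And>k. m \<le> u k" "0 < c" "0 < n"
  shows "a \<longlonglongrightarrow> 0"
proof -
  have "u (Suc k) \<le> u k" for k
  proof -
    have "0 \<le> a k ^ n / c" using assms(1)[of k] \<open>0 < c\<close> by simp
    with assms(2)[of k] show ?thesis by linarith
  qed
  then have "decseq u" by (rule decseq_SucI)
  then obtain l where l: "u \<longlonglongrightarrow> l"
    using assms(3) decseq_convergent by metis
  have "(\<lambda>k. c * (u k - u (Suc k))) \<longlonglongrightarrow> c * (l - l)"
    by (intro tendsto_mult_left tendsto_diff l LIMSEQ_Suc[OF l])
  then have lim: "(\<lambda>k. c * (u k - u (Suc k))) \<longlonglongrightarrow> 0" by simp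
  have "a k ^ n \<le> c * (u k - u (Suc k))" for k
    using assms(2)[of k] \<open>0 < c\<close> by (simp add: field_simps)
  then have "(\<lambda>k. a k ^ n) \<longlonglongrightarrow> 0"
    using assms(1) by (intro Lim_null_comparison[OF _ lim]) simp
  from tendsto_real_root[OF this, of n] show ?thesis
    using assms(1) \<open>0 < n\<close> by (simp add: real_root_power_cancel)
qed

text \<open>Stationarity conditions are invariant under positive scaling of the direction. The norm is made
  strictly smaller than one so that the bound \<open>\<le> 1\<close> survives a small perturbation of the base point.\<close>

lemma exists_short_rescaling:
  fixes d :: "'a::real_normed_vector"
  assumes "convex F" "z \<in> F" "z + d \<in> F"
  obtains t where "0 < t" "z + t *\<^sub>R d \<in> F" "norm (t *\<^sub>R d) < 1"
proof
  let ?t = "1 / (1 + norm d)"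
  have pos: "0 < 1 + norm d"
    using norm_ge_zero[of d] by linarith
  then show "0 < ?t" by simp
  have "0 \<le> ?t" "?t \<le> 1"
    using pos by (simp_all add: divide_le_eq)
  then show "z + ?t *\<^sub>R d \<in> F"
    by (rule convex_segment_point[OF assms])
  have "norm (?t *\<^sub>R d) = norm d / (1 + norm d)"
    using pos by simp
  with pos show "norm (?t *\<^sub>R d) < 1"
    by (simp add: divide_less_eq)
qed

lemma isCont_grad:
  assumes "twice_continuously_differentiable f"
  shows "isCont (grad f) z"
  using assms by (auto simp: twice_continuously_differentiable_def
      intro: differentiable_imp_continuous_within)

lemma isCont_hess:
  assumes "twice_continuously_differentiable f"
  shows "isCont (hess f) z"
  using assms by (auto simp: twice_continuously_differentiable_def continuous_on_eq_continuous_at)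

lemma first_order_stationary_limit:
  assumes tcd: "twice_continuously_differentiable f"
    and F: "closed F" "convex F" and y: "\<And>k. y k \<in> F" "y \<longlonglongrightarrow> z"
    and X: "(\<lambda>k. fo_measure f F (y k)) \<longlonglongrightarrow> 0"
  shows "first_order_stationary f F z"
  unfolding first_order_stationary_def
proof (intro conjI ballI)
  show z: "z \<in> F"
    using F(1) y closed_sequentially by blast
  fix w assume "w \<in> F"
  then have "z + (w - z) \<in> F" by simp
  from exists_short_rescaling[OF F(2) z this] obtain t where
    t: "0 < t" "z + t *\<^sub>R (w - z) \<in> F" "norm (t *\<^sub>R (w - z)) < 1" .
  define e where "e k = z + t *\<^sub>R (w - z) - y k" for k
  have e: "e \<longlonglongrightarrow> t *\<^sub>R (w - z)"
    using tendsto_diff[OF tendsto_const y(2), of "z + t *\<^sub>R (w - z)"] by (simp add: e_def[abs_def])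
  have "eventually (\<lambda>k. norm (e k) < 1) sequentially"
    using tendsto_norm[OF e] t(3) by (rule order_tendstoD)
  then have "eventually (\<lambda>k. - fo_measure f F (y k) \<le> grad f (y k) \<bullet> e k) sequentially"
  proof eventually_elim
    case (elim k)
    then have "linear_feasible F (y k) (e k)"
      using t(2) by (simp add: linear_feasible_def e_def)
    from fo_measure_ge[OF this, of f] show ?case by simp
  qed
  moreover have "(\<lambda>k. grad f (y k) \<bullet> e k) \<longlonglongrightarrow> grad f z \<bullet> (t *\<^sub>R (w - z))"
    by (rule tendsto_inner[OF isCont_tendsto_compose[OF isCont_grad[OF tcd] y(2)] e])
  moreover have "(\<lambda>k. - fo_measure f F (y k)) \<longlonglongrightarrow> 0"
    using tendsto_minus[OF X] by simp
  ultimately have "0 \<le> grad f z \<bullet> (t *\<^sub>R (w - z))"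
    by (intro tendsto_le[of sequentially]) auto
  with t(1) show "0 \<le> grad f z \<bullet> (w - z)"
    by (simp add: zero_le_mult_iff)
qed

text \<open>The bound \<open>b\<close> does not depend on the threshold \<open>c\<close>; only the neighbourhood of \<open>z\<close> does. A positive
  threshold leaves room for the slopes along the perturbed directions, which tend to zero but may be
  positive.\<close>

lemma so_measure_bounded_below_near_negative_curvature:
  assumes tcd: "twice_continuously_differentiable f"
    and F: "convex F" and y: "y \<longlonglongrightarrow> z" and z: "z \<in> F"
    and d: "d \<bullet> grad f z = 0" "z + d \<in> F" "d \<bullet> (hess f z *v d) < 0"
  obtains b where "0 < b"
    "\<And>c. 0 < c \<Longrightarrow> eventually (\<lambda>k. \<forall>a\<ge>c. b \<le> so_measure f F (y k) a) sequentially"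
proof -
  from exists_short_rescaling[OF F z d(2)] obtain t where
    t: "0 < t" "z + t *\<^sub>R d \<in> F" "norm (t *\<^sub>R d) < 1" .
  define e where "e k = z + t *\<^sub>R d - y k" for k
  \<comment> \<open>Half of the negative curvature along \<open>t *\<^sub>R d\<close>, so that a strict inequality persists near \<open>z\<close>.\<close>
  define b where "b = - ((t *\<^sub>R d) \<bullet> (hess f z *v (t *\<^sub>R d))) / 2"
  have "0 < b"
    using t(1) d(3) by (simp add: b_def matrix_vector_mult_scaleR mult_pos_neg)
  have e: "e \<longlonglongrightarrow> t *\<^sub>R d"
    using tendsto_diff[OF tendsto_const y, of "z + t *\<^sub>R d"] by (simp add: e_def[abs_def])
  have grad: "(\<lambda>k. grad f (y k) \<bullet> e k) \<longlonglongrightarrow> grad f z \<bullet> (t *\<^sub>R d)"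
    by (rule tendsto_inner[OF isCont_tendsto_compose[OF isCont_grad[OF tcd] y] e])
  have "(\<lambda>k. hess f (y k) *v e k) \<longlonglongrightarrow> hess f z *v (t *\<^sub>R d)"
    unfolding matrix_vector_mult_def
    by (intro vec_tendstoI, unfold vec_lambda_beta, intro tendsto_sum tendsto_mult tendsto_vec_nth)
      (rule isCont_tendsto_compose[OF isCont_hess[OF tcd] y], rule e)
  then have "(\<lambda>k. e k \<bullet> (hess f (y k) *v e k)) \<longlonglongrightarrow> (t *\<^sub>R d) \<bullet> (hess f z *v (t *\<^sub>R d))"
    by (rule tendsto_inner[OF e])
  moreover have "(t *\<^sub>R d) \<bullet> (hess f z *v (t *\<^sub>R d)) < - b"
    using \<open>0 < b\<close> unfolding b_def by simp
  ultimately have curv: "eventually (\<lambda>k. e k \<bullet> (hess f (y k) *v e k) < - b) sequentially"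
    by (rule order_tendstoD)
  have short: "eventually (\<lambda>k. norm (e k) < 1) sequentially"
    using tendsto_norm[OF e] t(3) by (rule order_tendstoD)
  have "eventually (\<lambda>k. \<forall>a\<ge>c. b \<le> so_measure f F (y k) a) sequentially" if "0 < c" for c
  proof -
    have "grad f z \<bullet> (t *\<^sub>R d) < c"
      using d(1) that by (simp add: inner_commute)
    with grad have "eventually (\<lambda>k. grad f (y k) \<bullet> e k < c) sequentially"
      by (rule order_tendstoD)
    with curv short show ?thesis
    proof eventually_elim
      case (elim k)
      have "b \<le> so_measure f F (y k) a" if "c \<le> a" for a
      proof -
        have "quadratic_feasible f F (y k) a (e k)"
          using elim t(2) that by (simp add: quadratic_feasible_def e_def)
        from so_measure_ge[OF this] elim(1) show ?thesis by simp
      qed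
      then show ?case by blast
    qed
  qed
  with \<open>0 < b\<close> that show thesis by blast
qed

theorem theorem5p5:
  fixes f :: "real^'n \<Rightarrow> real" and F :: "(real^'n) set"
    and fmin L \<rho> gmax Hmax \<gamma> \<alpha>0 :: real
    and x :: "nat \<Rightarrow> real^'n" and \<alpha> :: "nat \<Rightarrow> real"
  assumes "assumption_A f F fmin L \<rho> gmax Hmax x"
    and "assumption_B f F"
    and "\<gamma> > 1" and "0 < \<alpha>0" and "\<alpha>0 \<le> 1"
    and "sofw_run f F (max L gmax) (max \<rho> (2 * Hmax)) \<gamma> \<alpha>0 x \<alpha>"
  shows "(\<lambda>k. fo_measure f F (x k)) \<longlonglongrightarrow> 0
    \<and> (\<lambda>k. so_measure f F (x k) (\<alpha> k)) \<longlonglongrightarrow> 0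
    \<and> (\<forall>z. (\<exists>r. strict_mono r \<and> (x \<circ> r) \<longlonglongrightarrow> z) \<longrightarrow> second_order_stationary f F z)"
proof -
  define Lt where "Lt = max L gmax"
  define \<rho>t where "\<rho>t = max \<rho> (2 * Hmax)"
  note A = assms(1)[unfolded assumption_A_def]
  have tcd: "twice_continuously_differentiable f"
    and lip: "L-lipschitz_on F (grad f)"
    and F: "closed F" "convex F"
    and lb: "\<And>y. y \<in> F \<Longrightarrow> fmin \<le> f y"
    and hlip: "\<And>y z. y \<in> F \<Longrightarrow> z \<in> F \<Longrightarrow> spectral_norm (hess f y - hess f z) \<le> \<rho> * norm (y - z)"
    using A by auto
  have diff: "\<And>y. f differentiable (at y)" "\<And>y. grad f differentiable (at y)"
    using tcd by (auto simp: twice_continuously_differentiable_def)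
  have const: "L \<le> Lt" "0 < Lt" "\<rho> \<le> \<rho>t" "0 < \<rho>t"
    using A by (auto simp: Lt_def \<rho>t_def)
  have grad: "norm (grad f (x k)) \<le> Lt" for k
    using A by (auto simp: Lt_def intro: order_trans)
  have hess: "2 * spectral_norm (hess f (x k)) \<le> \<rho>t" for k
  proof -
    have "spectral_norm (hess f (x k)) \<le> Hmax" using A by blast
    then show ?thesis by (auto simp: \<rho>t_def)
  qed
  have run: "x 0 \<in> F"
    "\<And>k. \<exists>s. fo_minimizer f F (x k) s \<and> sofw_loop f F Lt \<rho>t \<gamma> (x k) s \<alpha>0 (\<alpha> k) (x (Suc k))"
    using assms(6) by (auto simp: sofw_run_def sofw_iteration_def Lt_def \<rho>t_def)
  have dec: "x (Suc k) \<in> F" "0 \<le> so_measure f F (x k) (\<alpha> k)"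
    "(fo_measure f F (x k))\<^sup>2 / (2 * Lt) \<le> f (x k) - f (x (Suc k))"
    "(so_measure f F (x k) (\<alpha> k)) ^ 3 / (3 * \<rho>t\<^sup>2) \<le> f (x k) - f (x (Suc k))"
    if "x k \<in> F" for k
    using run(2)[of k]
      sofw_loop_decrease[OF diff(1) lip const(1,2,4) F(2) that grad _ assms(3,4)] by blast+
  have xF: "x k \<in> F" for k
    by (induction k) (auto intro: run dec)
  have X: "(\<lambda>k. fo_measure f F (x k)) \<longlonglongrightarrow> 0"
    by (rule tendsto_0_if_power_bounded_by_decrease
        [where u = "\<lambda>k. f (x k)" and n = 2 and c = "2 * Lt" and m = fmin])
      (use const in \<open>auto intro: fo_measure_nonneg dec lb xF\<close>)
  have \<psi>: "(\<lambda>k. so_measure f F (x k) (\<alpha> k)) \<longlonglongrightarrow> 0"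
    by (rule tendsto_0_if_power_bounded_by_decrease
        [where u = "\<lambda>k. f (x k)" and n = 3 and c = "3 * \<rho>t\<^sup>2" and m = fmin])
      (use const in \<open>auto intro: dec lb xF\<close>)
  have "second_order_stationary f F z" if r: "strict_mono r" and lim: "(x \<circ> r) \<longlonglongrightarrow> z" for z r
  proof -
    have fo: "first_order_stationary f F z"
      using LIMSEQ_subseq_LIMSEQ[OF X r]
      by (intro first_order_stationary_limit[OF tcd F _ lim]) (auto simp: xF o_def)
    have "0 \<le> d \<bullet> (hess f z *v d)" if d: "d \<bullet> grad f z = 0" "z + d \<in> F" for d
    proof (rule ccontr)
      assume "\<not> 0 \<le> d \<bullet> (hess f z *v d)"
      then have neg: "d \<bullet> (hess f z *v d) < 0" by simp
      have "z \<in> F" using fo by (simp add: first_order_stationary_def)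
      from so_measure_bounded_below_near_negative_curvature[OF tcd F(2) lim this d neg]
      obtain b where b: "0 < b"
        "\<And>c. 0 < c \<Longrightarrow> eventually (\<lambda>k. \<forall>a\<ge>c. b \<le> so_measure f F (x (r k)) a) sequentially"
        by (auto simp: o_def)
      have "(\<lambda>n. \<alpha>0 / \<gamma> ^ n) \<longlonglongrightarrow> 0"
        using assms(3) by (intro tendsto_divide_0[OF tendsto_const] filterlim_realpow_sequentially_gt1)
            simp
      then have "eventually (\<lambda>n. \<alpha>0 / \<gamma> ^ n < b\<^sup>2 / (6 * \<rho>t)) sequentially"
        using b(1) const by (intro order_tendstoD) auto
      then obtain n where n: "\<alpha>0 / \<gamma> ^ n < b\<^sup>2 / (6 * \<rho>t)"
        by (auto simp: eventually_sequentially)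
      define c where "c = \<alpha>0 / \<gamma> ^ n"
      have "0 < c" using assms(3,4) by (simp add: c_def)
      have "eventually (\<lambda>k. so_measure f F (x (r k)) (\<alpha> (r k)) < b) sequentially"
        using LIMSEQ_subseq_LIMSEQ[OF \<psi> r] b(1) by (intro order_tendstoD) (auto simp: o_def)
      from eventually_conj[OF this b(2)[OF \<open>0 < c\<close>]]
      obtain k where k: "so_measure f F (x (r k)) (\<alpha> (r k)) < b"
        "\<And>a. c \<le> a \<Longrightarrow> b \<le> so_measure f F (x (r k)) a"
        by (auto simp: eventually_sequentially)
      obtain s where loop: "sofw_loop f F Lt \<rho>t \<gamma> (x (r k)) s \<alpha>0 (\<alpha> (r k)) (x (Suc (r k)))"
        using run(2) by blast
      have "b \<le> so_measure f F (x (r k)) (\<alpha> (r k))"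
        using n k(2) b(1) unfolding c_def
        by (intro so_measure_at_loop_exit_ge[OF diff hlip const(3,4) F(2) xF hess loop assms(3,4)]) auto
      with k(1) show False by linarith
    qed
    with fo show ?thesis
      by (simp add: second_order_stationary_def)
  qed
  with X \<psi> show ?thesis by blast
qed

end
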